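(* Consider the system $$\Delta_1:=u_t+u_xv+uv_x=0,\qquad\Delta_2:=v_t+vv_x=0 .$$ A projectable smooth vector field $$\mathbf w=\xi(x,t)\partial_x+\tau(x,t)\partial_t+\phi(x,t,u,v)\partial_u+\psi(x,t,u,v)\partial_v$$ on $\mathbb R^4$ is an infinitesimal symmetry of the system if and only if there are constants $c_1,\dots,c_8\in\mathbb R$ and a smooth function $\alpha(x,t,v)$ satisfying $$c_8+c_5v+\alpha_t+v\alpha_x=0$$ such that $$\xi=c_1+c_3t+(c_2+c_8t)x+c_5x^2,\qquad \tau=c_6+(c_7+c_8t)t+(c_4+c_5t)x,$$ $$\phi=u\,\alpha(x,t,v),$$ $$\psi=c_3+c_2v+2c_5xv+c_8(tv+x)-v(c_7+2c_8t+c_5x)-v^2(c_4+c_5t).$$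
   Context: The first prolongation of $\mathbf w$ is $\mathrm{pr}^{(1)}\mathbf w=\mathbf w+\phi^x\partial_{u_x}+\phi^t\partial_{u_t}+\psi^x\partial_{v_x}+\psi^t\partial_{v_t}$, a vector field on the first jet space with coordinates $(x,t,u,v,u_x,u_t,v_x,v_t)$, where, with $D_x,D_t$ the total derivatives and $\xi,\tau$ functions of $(x,t)$ only, $$\phi^x=D_x\phi-\xi_xu_x-\tau_xu_t,\quad \phi^t=D_t\phi-\xi_tu_x-\tau_tu_t,$$ $$\psi^x=D_x\psi-\xi_xv_x-\tau_xv_t,\quad \psi^t=D_t\psi-\xi_tv_x-\tau_tv_t .$$ Here $D_x\phi=\phi_x+\phi_uu_x+\phi_vv_x$, and similarly for the others. The vector field $\mathbf w$ is an infinitesimal symmetry of the system if $\mathrm{pr}^{(1)}\mathbf w(\Delta_1)=0$ and $\mathrm{pr}^{(1)}\mathbf w(\Delta_2)=0$ at all points of the jet space where $\Delta_1=\Delta_2=0$. Projectable means that $\xi,\tau$ do not depend on $u,v$. *)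

theory Defs
  imports "HOL-Analysis.Analysis"
begin

text \<open>
  Smoothness on the whole space. On a finite-dimensional domain, a function is \<open>C\<^sup>k\<^sup>+\<^sup>1\<close> iff it is
  differentiable and all its directional derivatives are \<open>C\<^sup>k\<close>.
\<close>

primrec cont_diff :: "nat \<Rightarrow> ('a::euclidean_space \<Rightarrow> 'b::real_normed_vector) \<Rightarrow> bool" where
  "cont_diff 0 f \<longleftrightarrow> continuous_on UNIV f"
| "cont_diff (Suc k) f \<longleftrightarrow>
     (\<forall>p. f differentiable (at p)) \<and> (\<forall>h. cont_diff k (\<lambda>p. frechet_derivative f (at p) h))"

definition smooth :: "('a::euclidean_space \<Rightarrow> 'b::real_normed_vector) \<Rightarrow> bool" where
  "smooth f \<longleftrightarrow> (\<forall>k. cont_diff k f)"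

text \<open>Coordinates \<open>(x, t, u, v)\<close> and \<open>(x, t, u, v, u_x, u_t, v_x, v_t)\<close>, in this order.\<close>

type_synonym base = "real \<times> real \<times> real \<times> real"
type_synonym jet = "real \<times> real \<times> real \<times> real \<times> real \<times> real \<times> real \<times> real"

text \<open>
  A vector field on a coordinate space is the map sending a point to the tuple of coefficients of
  the coordinate fields; this is its action on functions as a first-order differential operator.
\<close>

definition vf_apply :: "('a::euclidean_space \<Rightarrow> 'a) \<Rightarrow> ('a \<Rightarrow> real) \<Rightarrow> 'a \<Rightarrow> real" where
  "vf_apply X F p = frechet_derivative F (at p) (X p)"

fun total_dx :: "(base \<Rightarrow> real) \<Rightarrow> jet \<Rightarrow> real" where
  "total_dx f (x, t, u, v, ux, ut, vx, vt) =
     deriv (\<lambda>s. f (s, t, u, v)) x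
     + deriv (\<lambda>s. f (x, t, s, v)) u * ux
     + deriv (\<lambda>s. f (x, t, u, s)) v * vx"

fun total_dt :: "(base \<Rightarrow> real) \<Rightarrow> jet \<Rightarrow> real" where
  "total_dt f (x, t, u, v, ux, ut, vx, vt) =
     deriv (\<lambda>s. f (x, s, u, v)) t
     + deriv (\<lambda>s. f (x, t, s, v)) u * ut
     + deriv (\<lambda>s. f (x, t, u, s)) v * vt"

text \<open>
  First prolongation of the projectable field
  \<open>\<xi>(x,t) \<partial>\<^sub>x + \<tau>(x,t) \<partial>\<^sub>t + \<phi>(x,t,u,v) \<partial>\<^sub>u + \<psi>(x,t,u,v) \<partial>\<^sub>v\<close>.
\<close>

fun prolong ::
  "(real \<times> real \<Rightarrow> real) \<Rightarrow> (real \<times> real \<Rightarrow> real) \<Rightarrow> (base \<Rightarrow> real) \<Rightarrow> (base \<Rightarrow> real) \<Rightarrow> jet \<Rightarrow> jet"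
where
  "prolong \<xi> \<tau> \<phi> \<psi> (x, t, u, v, ux, ut, vx, vt) =
     (let p = (x, t, u, v, ux, ut, vx, vt);
          \<xi>x = deriv (\<lambda>s. \<xi> (s, t)) x; \<xi>t = deriv (\<lambda>s. \<xi> (x, s)) t;
          \<tau>x = deriv (\<lambda>s. \<tau> (s, t)) x; \<tau>t = deriv (\<lambda>s. \<tau> (x, s)) t
      in (\<xi> (x, t), \<tau> (x, t), \<phi> (x, t, u, v), \<psi> (x, t, u, v),
          total_dx \<phi> p - \<xi>x * ux - \<tau>x * ut,
          total_dt \<phi> p - \<xi>t * ux - \<tau>t * ut,
          total_dx \<psi> p - \<xi>x * vx - \<tau>x * vt,
          total_dt \<psi> p - \<xi>t * vx - \<tau>t * vt))"

fun Delta1 :: "jet \<Rightarrow> real" where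
  "Delta1 (x, t, u, v, ux, ut, vx, vt) = ut + ux * v + u * vx"

fun Delta2 :: "jet \<Rightarrow> real" where
  "Delta2 (x, t, u, v, ux, ut, vx, vt) = vt + v * vx"

definition infinitesimal_symmetry ::
  "(real \<times> real \<Rightarrow> real) \<Rightarrow> (real \<times> real \<Rightarrow> real) \<Rightarrow> (base \<Rightarrow> real) \<Rightarrow> (base \<Rightarrow> real) \<Rightarrow> bool"
where
  "infinitesimal_symmetry \<xi> \<tau> \<phi> \<psi> \<longleftrightarrow>
     (\<forall>p. Delta1 p = 0 \<and> Delta2 p = 0 \<longrightarrow>
        vf_apply (prolong \<xi> \<tau> \<phi> \<psi>) Delta1 p = 0 \<and> vf_apply (prolong \<xi> \<tau> \<phi> \<psi>) Delta2 p = 0)"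

end

theory Submission
  imports Defs
begin

text \<open>
  On the solution manifold \<open>u_t = - u_x v - u v_x\<close>, \<open>v_t = - v v_x\<close> the symmetry condition is affine in
  the free jet coordinates \<open>u_x\<close>, \<open>v_x\<close>, and comparing coefficients gives the determining equations.
  They force \<open>\<psi> = \<xi>\<^sub>t + v (\<xi>\<^sub>x - \<tau>\<^sub>t) - v\<^sup>2 \<tau>\<^sub>x\<close> and \<open>\<phi> = u \<phi>\<^sub>u\<close>. The former turns
  \<open>\<psi>\<^sub>t + v \<psi>\<^sub>x = 0\<close> into four equations for \<open>\<xi>\<close> and \<open>\<tau>\<close>, the coefficients of a cubic polynomial in \<open>v\<close>;
  the latter makes \<open>\<phi>\<close> linear in \<open>u\<close>, differentiability at \<open>u = 0\<close> gluing the two half-lines.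
\<close>

section \<open>Determining equations of the symmetry condition\<close>

lemma has_derivative_Delta1:
  "(Delta1 has_derivative (\<lambda>(dx, dt, du, dv, dux, dut, dvx, dvt).
     dut + dux * v + ux * dv + du * vx + u * dvx)) (at (x, t, u, v, ux, ut, vx, vt))"
proof -
  \<comment> \<open>Projections replace pattern matching so that the derivative rules for sums and
    products apply.\<close>
  have eq: "Delta1 = (\<lambda>p. fst (snd (snd (snd (snd (snd p))))) +
      fst (snd (snd (snd (snd p)))) * fst (snd (snd (snd p))) +
      fst (snd (snd p)) * fst (snd (snd (snd (snd (snd (snd p)))))))"
    by (auto simp: fun_eq_iff)
  show ?thesis
    unfolding eq by (auto intro!: derivative_eq_intros simp: fun_eq_iff)
qed

lemma has_derivative_Delta2:
  "(Delta2 has_derivative (\<lambda>(dx, dt, du, dv, dux, dut, dvx, dvt).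
     dvt + dv * vx + v * dvx)) (at (x, t, u, v, ux, ut, vx, vt))"
proof -
  have eq: "Delta2 = (\<lambda>p. snd (snd (snd (snd (snd (snd (snd p)))))) +
      fst (snd (snd (snd p))) * fst (snd (snd (snd (snd (snd (snd p)))))))"
    by (auto simp: fun_eq_iff)
  show ?thesis
    unfolding eq by (auto intro!: derivative_eq_intros simp: fun_eq_iff)
qed

text \<open>The system can be solved for \<open>ut\<close> and \<open>vt\<close>, so its solution
  set is a graph over the other six coordinates. On it \<open>vt + v * vx\<close> vanishes and
  \<open>ut + v * ux\<close> equals \<open>- u * vx\<close>. This removes the v-derivative of \<phi>
  altogether and that of \<psi> from the second condition.\<close>

lemma infinitesimal_symmetry_on_solution_manifold:
  "infinitesimal_symmetry \<xi> \<tau> \<phi> \<psi> \<longleftrightarrow> (\<forall>x t u v ux vx.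
     (let \<xi>x = deriv (\<lambda>s. \<xi> (s, t)) x; \<xi>t = deriv (\<lambda>s. \<xi> (x, s)) t;
          \<tau>x = deriv (\<lambda>s. \<tau> (s, t)) x; \<tau>t = deriv (\<lambda>s. \<tau> (x, s)) t;
          \<phi>x = deriv (\<lambda>s. \<phi> (s, t, u, v)) x; \<phi>t = deriv (\<lambda>s. \<phi> (x, s, u, v)) t;
          \<phi>u = deriv (\<lambda>s. \<phi> (x, t, s, v)) u;
          \<psi>x = deriv (\<lambda>s. \<psi> (s, t, u, v)) x; \<psi>t = deriv (\<lambda>s. \<psi> (x, s, u, v)) t;
          \<psi>u = deriv (\<lambda>s. \<psi> (x, t, s, v)) u; \<psi>v = deriv (\<lambda>s. \<psi> (x, t, u, s)) v
      in (\<phi>t + v * \<phi>x + u * \<psi>x)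
           + ux * (\<psi> (x, t, u, v) + u * \<psi>u - \<xi>t + v * \<tau>t - v * \<xi>x + v\<^sup>2 * \<tau>x)
           + vx * (\<phi> (x, t, u, v) - u * \<phi>u + u * (\<psi>v - \<xi>x + \<tau>t + 2 * v * \<tau>x)) = 0 \<and>
         (\<psi>t + v * \<psi>x)
           + vx * (\<psi> (x, t, u, v) - u * \<psi>u - \<xi>t + v * \<tau>t - v * \<xi>x + v\<^sup>2 * \<tau>x) = 0))"
proof -
  have on_solutions: "(\<forall>p. Delta1 p = 0 \<and> Delta2 p = 0 \<longrightarrow> P p) \<longleftrightarrow>
      (\<forall>x t u v ux vx. P (x, t, u, v, ux, - (ux * v) - u * vx, vx, - (v * vx)))" for P
  proof (intro iffI allI impI)
    fix p
    assume *: "\<forall>x t u v ux vx. P (x, t, u, v, ux, - (ux * v) - u * vx, vx, - (v * vx))"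
      and sol: "Delta1 p = 0 \<and> Delta2 p = 0"
    obtain x t u v ux ut vx vt where p: "p = (x, t, u, v, ux, ut, vx, vt)"
      by (metis prod.exhaust)
    then have "ut = - (ux * v) - u * vx" "vt = - (v * vx)"
      using sol by (auto simp: algebra_simps)
    then show "P p"
      using * p by simp
  qed simp
  show ?thesis
    unfolding infinitesimal_symmetry_def on_solutions vf_apply_def
      frechet_derivative_at[OF has_derivative_Delta1, symmetric]
      frechet_derivative_at[OF has_derivative_Delta2, symmetric]
      prolong.simps total_dx.simps total_dt.simps Let_def prod.case
    by (simp add: algebra_simps power2_eq_square)
qed

text \<open>An expression affine in \<open>ux\<close> and \<open>vx\<close> vanishes identically
  exactly when its coefficients do. The coefficient of \<open>ux\<close> in the first condition and
  that of \<open>vx\<close> in the second differ only in the sign of u times the u-derivative of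
  \<psi>. Their sum gives the formula for \<psi>, their difference the vanishing of that
  term.\<close>

lemma determining_equations:
  "infinitesimal_symmetry \<xi> \<tau> \<phi> \<psi> \<longleftrightarrow> (\<forall>x t u v.
     (let \<xi>x = deriv (\<lambda>s. \<xi> (s, t)) x; \<xi>t = deriv (\<lambda>s. \<xi> (x, s)) t;
          \<tau>x = deriv (\<lambda>s. \<tau> (s, t)) x; \<tau>t = deriv (\<lambda>s. \<tau> (x, s)) t;
          \<phi>x = deriv (\<lambda>s. \<phi> (s, t, u, v)) x; \<phi>t = deriv (\<lambda>s. \<phi> (x, s, u, v)) t;
          \<phi>u = deriv (\<lambda>s. \<phi> (x, t, s, v)) u;
          \<psi>x = deriv (\<lambda>s. \<psi> (s, t, u, v)) x; \<psi>t = deriv (\<lambda>s. \<psi> (x, s, u, v)) t;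
          \<psi>v = deriv (\<lambda>s. \<psi> (x, t, u, s)) v
      in \<phi>t + v * \<phi>x + u * \<psi>x = 0 \<and> \<psi>t + v * \<psi>x = 0 \<and>
         u * deriv (\<lambda>s. \<psi> (x, t, s, v)) u = 0 \<and>
         \<psi> (x, t, u, v) = \<xi>t + v * (\<xi>x - \<tau>t) - v\<^sup>2 * \<tau>x \<and>
         \<phi> (x, t, u, v) - u * \<phi>u + u * (\<psi>v - \<xi>x + \<tau>t + 2 * v * \<tau>x) = 0))"
proof -
  have affine: "(\<forall>a b. p + a * q + b * r = 0 \<and> p' + b * r' = 0) \<longleftrightarrow>
      p = 0 \<and> q = 0 \<and> r = 0 \<and> p' = 0 \<and> r' = 0" for p q r p' r' :: real
  proof (intro iffI)
    assume *: "\<forall>a b. p + a * q + b * r = 0 \<and> p' + b * r' = 0"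
    from *[rule_format, of 0 0] *[rule_format, of 1 0] *[rule_format, of 0 1]
    show "p = 0 \<and> q = 0 \<and> r = 0 \<and> p' = 0 \<and> r' = 0"
      by auto
  qed simp
  \<comment> \<open>\<open>y\<close> stands for the value of \<psi>, \<open>q\<close> for u times
    its u-derivative and \<open>w\<close> for \<open>v\<^sup>2\<close>.\<close>
  have separate: "a = 0 \<and> y + q - \<xi>t + v * \<tau>t - v * \<xi>x + w * \<tau>x = 0 \<and> b = 0 \<and> d = 0 \<and>
        y - q - \<xi>t + v * \<tau>t - v * \<xi>x + w * \<tau>x = 0 \<longleftrightarrow>
      a = 0 \<and> d = 0 \<and> q = 0 \<and> y = \<xi>t + v * (\<xi>x - \<tau>t) - w * \<tau>x \<and> b = 0"
    for a b d q v w y \<xi>t \<xi>x \<tau>t \<tau>x :: real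
    unfolding right_diff_distrib by linarith
  show ?thesis
    unfolding infinitesimal_symmetry_on_solution_manifold Let_def affine separate ..
qed

section \<open>Smooth functions and one-variable calculus\<close>

lemma smooth_imp_differentiable: "smooth f \<Longrightarrow> f differentiable (at p)"
  unfolding smooth_def by (metis cont_diff.simps(2))

text \<open>The derivative \<open>L\<close> is the same at every point, so differentiating
  \<open>f\<close> after \<open>A\<close> in direction \<open>h\<close> gives the derivative of
  \<open>f\<close> in the fixed direction \<open>L h\<close>, again composed with \<open>A\<close>.
  The induction therefore reproduces its own form, without a general chain rule of higher
  order.\<close>

lemma cont_diff_compose_affine:
  fixes f :: "'a::euclidean_space \<Rightarrow> 'b::real_normed_vector"
    and A :: "'c::euclidean_space \<Rightarrow> 'a"
  assumes "\<And>p. (A has_derivative L) (at p)" and "cont_diff k f"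
  shows "cont_diff k (\<lambda>p. f (A p))"
  using assms(2)
proof (induction k arbitrary: f)
  case 0
  have "continuous_on UNIV A"
    by (simp add: continuous_at_imp_continuous_on has_derivative_continuous[OF assms(1)])
  with 0 show ?case
    using continuous_on_compose2[of UNIV f UNIV A] by simp
next
  case (Suc k)
  have "((\<lambda>p. f (A p)) has_derivative (\<lambda>h. frechet_derivative f (at (A p)) (L h))) (at p)" for p
    using Suc.prems diff_chain_at[OF assms(1)] frechet_derivative_works
    by (fastforce simp: o_def)
  moreover from this have "frechet_derivative (\<lambda>p. f (A p)) (at p) =
      (\<lambda>h. frechet_derivative f (at (A p)) (L h))" for p
    using frechet_derivative_at by metis
  moreover have "cont_diff k (\<lambda>p. frechet_derivative f (at (A p)) (L h))" for h
    using Suc.IH[of "\<lambda>p. frechet_derivative f (at p) (L h)"] Suc.prems by simp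
  ultimately show ?case
    by (auto simp: differentiable_def)
qed

text \<open>With \<open>g\<close> running along a coordinate line, this makes the partial
  derivatives written with \<open>deriv\<close> genuine derivatives.\<close>

lemma DERIV_deriv_compose:
  fixes f :: "'a::real_normed_vector \<Rightarrow> real" and g :: "real \<Rightarrow> 'a"
  assumes "\<And>p. f differentiable (at p)" and "g differentiable (at s)"
  shows "((\<lambda>s. f (g s)) has_real_derivative deriv (\<lambda>s. f (g s)) s) (at s)"
proof -
  have "(\<lambda>s. f (g s)) differentiable (at s)"
    using differentiable_chain_at[OF assms(2,1)] by (simp add: o_def)
  then show ?thesis
    by (simp add: DERIV_deriv_iff_real_differentiable)
qed

lemma DERIV_const_imp_affine:
  fixes f :: "real \<Rightarrow> real"
  assumes "\<And>s. (f has_real_derivative m) (at s)"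
  shows "f s = f 0 + m * s"
proof -
  have "((\<lambda>s. f s - m * s) has_real_derivative 0) (at s)" for s
    by (auto intro!: derivative_eq_intros assms)
  then have "f s - m * s = f 0 - m * 0"
    using DERIV_isconst_all by blast
  then show ?thesis
    by simp
qed

lemma DERIV_affine_imp_quadratic:
  fixes f :: "real \<Rightarrow> real"
  assumes "\<And>s. (f has_real_derivative m + 2 * n * s) (at s)"
  shows "f s = f 0 + m * s + n * s\<^sup>2"
proof -
  have "((\<lambda>s. f s - n * s\<^sup>2) has_real_derivative m) (at s)" for s
    by (auto intro!: derivative_eq_intros assms)
  from DERIV_const_imp_affine[OF this, of s] show ?thesis
    by simp
qed

text \<open>By Euler's relation \<open>f s / s\<close> has derivative zero, hence is constant on the
  positive half-line. Since \<open>f 0 = 0\<close>, its limit at 0 from the right is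
  \<open>f' 0\<close>, which identifies the constant.\<close>

lemma Euler_homogeneous_imp_linear_pos:
  fixes f :: "real \<Rightarrow> real"
  assumes deriv: "\<And>s. (f has_real_derivative f' s) (at s)" and Euler: "\<And>s. f s = s * f' s"
    and "s > 0"
  shows "f s = s * f' 0"
proof -
  have quotient: "((\<lambda>s. f s / s) has_real_derivative 0) (at r)" if "r > 0" for r
    using that Euler[of r] by (auto intro!: derivative_eq_intros deriv)
  \<comment> \<open>The open interval from 0 to \<open>r + s\<close> contains both points.\<close>
  have const: "f r / r = f s / s" if "r > 0" for r
    by (rule DERIV_isconst3[where a = 0 and b = "r + s"]) (use that \<open>s > 0\<close> quotient in auto)
  have "((\<lambda>h. f h / h) \<longlongrightarrow> f' 0) (at 0)"
    using deriv[of 0] Euler[of 0] by (simp add: DERIV_def)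
  then have "((\<lambda>h. f h / h) \<longlongrightarrow> f' 0) (at_right 0)"
    by (rule tendsto_within_subset) simp
  moreover have "((\<lambda>h. f h / h) \<longlongrightarrow> f s / s) (at_right 0)"
    by (rule tendsto_eventually) (auto simp: eventually_at_filter const)
  ultimately have "f' 0 = f s / s"
    by (rule tendsto_unique[OF trivial_limit_at_right_real])
  with \<open>s > 0\<close> show ?thesis
    by simp
qed

text \<open>Reflection carries the positive case to the negative half-line. Both slopes equal
  \<open>f' 0\<close>, and \<open>f 1\<close> is that common value.\<close>

lemma Euler_homogeneous_imp_linear:
  fixes f :: "real \<Rightarrow> real"
  assumes deriv: "\<And>s. (f has_real_derivative f' s) (at s)" and Euler: "\<And>s. f s = s * f' s"
  shows "f s = s * f 1"
proof -
  have pos: "f r = r * f' 0" if "r > 0" for r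
    using Euler_homogeneous_imp_linear_pos[OF assms that] .
  have neg: "f (- r) = r * (- f' 0)" if "r > 0" for r
  proof -
    have "((\<lambda>s. f (- s)) has_real_derivative - f' (- s)) (at s)" for s
      using DERIV_chain2[OF deriv DERIV_minus[OF DERIV_ident]] by simp
    moreover have "f (- s) = s * - f' (- s)" for s
      using Euler[of "- s"] by simp
    ultimately have "f (- r) = r * - f' (- 0)"
      using that by (rule Euler_homogeneous_imp_linear_pos)
    then show ?thesis
      by simp
  qed
  have "f s = s * f' 0"
    using pos[of s] neg[of "- s"] Euler[of 0] by (cases s "0 :: real" rule: linorder_cases) auto
  with pos[of 1] show ?thesis
    by simp
qed

section \<open>Solving for the coefficients \<xi> and \<tau>\<close>

text \<open>
  Here \<open>\<psi> = A + v B + v\<^sup>2 C\<close>, and the last four hypotheses say that the coefficients of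
  \<open>1, v, v\<^sup>2, v\<^sup>3\<close> in \<open>\<psi>\<^sub>t + v \<psi>\<^sub>x\<close> vanish. Only first derivatives of \<open>\<xi>\<close>, \<open>\<tau>\<close> and \<open>\<psi>\<close> enter,
  so no symmetry of mixed derivatives is needed.
\<close>

lemma coefficient_equations_solution:
  fixes \<xi> \<tau> :: "real \<times> real \<Rightarrow> real" and A B C :: "real \<Rightarrow> real \<Rightarrow> real"
  assumes \<xi>x: "\<And>x t. ((\<lambda>s. \<xi> (s, t)) has_real_derivative \<xi>x x t) (at x)"
    and \<xi>t: "\<And>x t. ((\<lambda>s. \<xi> (x, s)) has_real_derivative A x t) (at t)"
    and \<tau>x: "\<And>x t. ((\<lambda>s. \<tau> (s, t)) has_real_derivative - C x t) (at x)"
    and \<tau>t: "\<And>x t. ((\<lambda>s. \<tau> (x, s)) has_real_derivative \<tau>t x t) (at t)"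
    and B: "\<And>x t. B x t = \<xi>x x t - \<tau>t x t"
    and Ax: "\<And>x t. ((\<lambda>s. A s t) has_real_derivative Ax x t) (at x)"
    and Ct: "\<And>x t. ((\<lambda>s. C x s) has_real_derivative Ct x t) (at t)"
    and At: "\<And>x t. ((\<lambda>s. A x s) has_real_derivative 0) (at t)"
    and Bt: "\<And>x t. ((\<lambda>s. B x s) has_real_derivative - Ax x t) (at t)"
    and Bx: "\<And>x t. ((\<lambda>s. B s t) has_real_derivative - Ct x t) (at x)"
    and Cx: "\<And>x t. ((\<lambda>s. C s t) has_real_derivative 0) (at x)"
  obtains c1 c2 c3 c4 c5 c6 c7 c8 where
    "\<And>x t. \<xi> (x, t) = c1 + c3 * t + (c2 + c8 * t) * x + c5 * x\<^sup>2"
    "\<And>x t. \<tau> (x, t) = c6 + (c7 + c8 * t) * t + (c4 + c5 * t) * x"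
proof -
  have A0: "A x t = A x 0" for x t
    using DERIV_const_imp_affine[OF At, of x t] by simp
  have C0: "C x t = C 0 t" for x t
    using DERIV_const_imp_affine[OF Cx, of x t] by simp
  have Ax0: "Ax x t = Ax x 0" for x t
    using Ax[of t x] Ax[of 0 x] unfolding A0[of _ t] by (rule DERIV_unique)
  have Ct0: "Ct x t = Ct 0 t" for x t
    using Ct[of x t] Ct[of 0 t] unfolding C0[of x] by (rule DERIV_unique)
  have Bt': "B x t = B x 0 - t * Ax x 0" for x t
  proof -
    have "(B x has_real_derivative - Ax x 0) (at s)" for s
      using Bt[of x s] Ax0[of x s] by simp
    from DERIV_const_imp_affine[OF this, of t] show ?thesis
      by simp
  qed
  have Bx': "B x t = B 0 t - x * Ct 0 t" for x t
  proof -
    have "((\<lambda>s. B s t) has_real_derivative - Ct 0 t) (at s)" for s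
      using Bx[of t s] Ct0[of s t] by simp
    from DERIV_const_imp_affine[OF this, of x] show ?thesis
      by simp
  qed
  have \<xi>': "\<xi> (x, t) = \<xi> (x, 0) + A x 0 * t" for x t
  proof (rule DERIV_const_imp_affine)
    show "((\<lambda>s. \<xi> (x, s)) has_real_derivative A x 0) (at s)" for s
      using \<xi>t[of x s] A0[of x s] by simp
  qed
  have \<tau>': "\<tau> (x, t) = \<tau> (0, t) - C 0 t * x" for x t
  proof -
    have "((\<lambda>s. \<tau> (s, t)) has_real_derivative - C 0 t) (at s)" for s
      using \<tau>x[of t s] C0[of s t] by simp
    from DERIV_const_imp_affine[OF this, of x] show ?thesis
      by simp
  qed
  have \<xi>x': "\<xi>x x t = \<xi>x x 0 + Ax x 0 * t" for x t
  proof (rule DERIV_unique[OF \<xi>x])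
    show "((\<lambda>s. \<xi> (s, t)) has_real_derivative \<xi>x x 0 + Ax x 0 * t) (at x)"
      unfolding \<xi>'[of _ t] by (auto intro!: derivative_eq_intros \<xi>x Ax)
  qed
  have \<tau>t': "\<tau>t x t = \<tau>t 0 t - Ct 0 t * x" for x t
  proof (rule DERIV_unique[OF \<tau>t])
    show "((\<lambda>s. \<tau> (x, s)) has_real_derivative \<tau>t 0 t - Ct 0 t * x) (at t)"
      unfolding \<tau>'[of x] by (auto intro!: derivative_eq_intros \<tau>t Ct)
  qed
  define k where "k = Ax 1 0 - Ax 0 0"
  \<comment> \<open>\<open>B x t\<close> is reached from \<open>B 0 0\<close> along the two sides of
    a rectangle, in either order. Comparison makes \<open>Ax x 0\<close> and \<open>Ct 0 t\<close>
    affine with the same slope \<open>k\<close>.\<close>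
  have exchange: "x * Ct 0 0 + t * Ax x 0 = t * Ax 0 0 + x * Ct 0 t" for x t
    using Bt'[of x t] Bx'[of x t] Bt'[of 0 t] Bx'[of x 0] by simp
  have Ax_affine: "Ax x 0 = Ax 0 0 + k * x" for x
  proof -
    have "Ct 0 1 = Ct 0 0 + k"
      using exchange[of 1 1] by (simp add: k_def)
    from exchange[of x 1, unfolded this] show ?thesis
      by (simp add: algebra_simps)
  qed
  have Ct_affine: "Ct 0 t = Ct 0 0 + k * t" for t
    using exchange[of 1 t] by (simp add: k_def algebra_simps)
  have separated: "\<xi>x x 0 - \<tau>t 0 t = B 0 0 - 2 * Ct 0 0 * x - 2 * Ax 0 0 * t - 3 * k * x * t"
    for x t
    using B[of x t] \<xi>x'[of x t] \<tau>t'[of x t] Bt'[of x t] Bx'[of x 0] Ax_affine[of x] Ct_affine[of t]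
    by (simp add: algebra_simps)
  \<comment> \<open>The left side of \<open>separated\<close> is a function of x plus a function of
    t, so its mixed second difference over the unit square vanishes, while the right side
    contributes \<open>- 3 * k\<close>.\<close>
  have "k = 0"
    using separated[of 0 0] separated[of 1 0] separated[of 0 1] separated[of 1 1] by simp
  have \<xi>x0: "\<xi>x x 0 = \<xi>x 0 0 + 2 * (- Ct 0 0) * x" for x
    using separated[of 0 0] separated[of x 0] by simp
  have \<tau>t0: "\<tau>t 0 t = \<tau>t 0 0 + 2 * Ax 0 0 * t" for t
    using separated[of 0 0] separated[of 0 t] by simp
  have A: "A x 0 = A 0 0 + Ax 0 0 * x" for x
  proof (rule DERIV_const_imp_affine)
    show "((\<lambda>s. A s 0) has_real_derivative Ax 0 0) (at s)" for s
      using Ax[of 0 s] Ax_affine[of s] \<open>k = 0\<close> by simp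
  qed
  have C: "C 0 t = C 0 0 + Ct 0 0 * t" for t
  proof (rule DERIV_const_imp_affine)
    show "(C 0 has_real_derivative Ct 0 0) (at s)" for s
      using Ct[of 0 s] Ct_affine[of s] \<open>k = 0\<close> by simp
  qed
  have \<xi>0: "\<xi> (x, 0) = \<xi> (0, 0) + \<xi>x 0 0 * x + (- Ct 0 0) * x\<^sup>2" for x
  proof (rule DERIV_affine_imp_quadratic)
    show "((\<lambda>s. \<xi> (s, 0)) has_real_derivative \<xi>x 0 0 + 2 * (- Ct 0 0) * s) (at s)" for s
      using \<xi>x[of 0 s] \<xi>x0[of s] by simp
  qed
  have \<tau>0: "\<tau> (0, t) = \<tau> (0, 0) + \<tau>t 0 0 * t + Ax 0 0 * t\<^sup>2" for t
  proof (rule DERIV_affine_imp_quadratic)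
    show "((\<lambda>s. \<tau> (0, s)) has_real_derivative \<tau>t 0 0 + 2 * Ax 0 0 * s) (at s)" for s
      using \<tau>t[of 0 s] \<tau>t0[of s] by simp
  qed
  \<comment> \<open>The shared constants are \<open>c8 = Ax 0 0\<close> and
    \<open>c5 = - Ct 0 0\<close>: each is the coefficient of the mixed term in one of \<xi>, \<tau>
    and of the pure square in the other.\<close>
  show thesis
  proof
    show "\<xi> (x, t) = \<xi> (0, 0) + A 0 0 * t + (\<xi>x 0 0 + Ax 0 0 * t) * x + (- Ct 0 0) * x\<^sup>2" for x t
      unfolding \<xi>'[of x t] \<xi>0[of x] A[of x] by (simp add: algebra_simps)
    show "\<tau> (x, t) = \<tau> (0, 0) + (\<tau>t 0 0 + Ax 0 0 * t) * t + (- C 0 0 + (- Ct 0 0) * t) * x" for x t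
      unfolding \<tau>'[of x t] \<tau>0[of t] C[of t] by (simp add: algebra_simps power2_eq_square)
  qed
qed

lemma deriv_base_coefficients:
  assumes \<xi>: "\<And>x t. \<xi> (x, t) = c1 + c3 * t + (c2 + c8 * t) * x + c5 * x\<^sup>2"
    and \<tau>: "\<And>x t. \<tau> (x, t) = c6 + (c7 + c8 * t) * t + (c4 + c5 * t) * (x::real)"
  shows "deriv (\<lambda>s. \<xi> (s, t)) x = c2 + c8 * t + 2 * c5 * x" (is ?\<xi>x)
    and "deriv (\<lambda>s. \<xi> (x, s)) t = c3 + c8 * x" (is ?\<xi>t)
    and "deriv (\<lambda>s. \<tau> (s, t)) x = c4 + c5 * t" (is ?\<tau>x)
    and "deriv (\<lambda>s. \<tau> (x, s)) t = c7 + 2 * c8 * t + c5 * x" (is ?\<tau>t)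
proof -
  show ?\<xi>x ?\<xi>t ?\<tau>x ?\<tau>t
    unfolding \<xi> \<tau> by (rule DERIV_imp_deriv, auto intro!: derivative_eq_intros)+
qed

text \<open>The formula for \<psi> is quadratic in v and free of u, so u is set to 0. Its
  coefficients are combinations of values of \<psi> and inherit differentiability from
  \<psi>.\<close>

lemma infinitesimal_symmetry_imp_base_coefficients:
  assumes smooth: "smooth \<xi>" "smooth \<tau>" "smooth \<psi>"
    and sym: "infinitesimal_symmetry \<xi> \<tau> \<phi> \<psi>"
  obtains c1 c2 c3 c4 c5 c6 c7 c8 where
    "\<And>x t. \<xi> (x, t) = c1 + c3 * t + (c2 + c8 * t) * x + c5 * x\<^sup>2"
    "\<And>x t. \<tau> (x, t) = c6 + (c7 + c8 * t) * t + (c4 + c5 * t) * x"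
proof -
  define \<xi>x \<xi>t \<tau>x \<tau>t where
    "\<xi>x = (\<lambda>x t. deriv (\<lambda>s. \<xi> (s, t)) x)" and "\<xi>t = (\<lambda>x t. deriv (\<lambda>s. \<xi> (x, s)) t)" and
    "\<tau>x = (\<lambda>x t. deriv (\<lambda>s. \<tau> (s, t)) x)" and "\<tau>t = (\<lambda>x t. deriv (\<lambda>s. \<tau> (x, s)) t)"
  define \<psi>x \<psi>t where
    "\<psi>x = (\<lambda>x t v. deriv (\<lambda>s. \<psi> (s, t, 0, v)) x)" and
    "\<psi>t = (\<lambda>x t v. deriv (\<lambda>s. \<psi> (x, s, 0, v)) t)"
  note defs = \<xi>x_def \<xi>t_def \<tau>x_def \<tau>t_def \<psi>x_def \<psi>t_def
  have transport: "\<psi>t x t v + v * \<psi>x x t v = 0"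
    and \<psi>: "\<psi> (x, t, 0, v) = \<xi>t x t + v * (\<xi>x x t - \<tau>t x t) - v\<^sup>2 * \<tau>x x t" for x t v
    using sym unfolding determining_equations Let_def defs by blast+
  note D = DERIV_deriv_compose[OF smooth_imp_differentiable]
  have \<xi>x: "((\<lambda>s. \<xi> (s, t)) has_real_derivative \<xi>x x t) (at x)"
    and \<xi>t: "((\<lambda>s. \<xi> (x, s)) has_real_derivative \<xi>t x t) (at t)"
    and \<tau>x: "((\<lambda>s. \<tau> (s, t)) has_real_derivative \<tau>x x t) (at x)"
    and \<tau>t: "((\<lambda>s. \<tau> (x, s)) has_real_derivative \<tau>t x t) (at t)"
    and \<psi>x: "((\<lambda>s. \<psi> (s, t, 0, v)) has_real_derivative \<psi>x x t v) (at x)"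
    and \<psi>t: "((\<lambda>s. \<psi> (x, s, 0, v)) has_real_derivative \<psi>t x t v) (at t)" for x t v
    unfolding defs by (intro D smooth; auto intro!: derivative_intros)+
  define B where "B = (\<lambda>x t. \<xi>x x t - \<tau>t x t)"
  \<comment> \<open>Interpolation of the quadratic at v = 0, 1, -1.\<close>
  have A_eq: "\<xi>t x t = \<psi> (x, t, 0, 0)"
    and B_eq: "B x t = (\<psi> (x, t, 0, 1) - \<psi> (x, t, 0, - 1)) / 2"
    and C_eq: "- \<tau>x x t = (\<psi> (x, t, 0, 1) + \<psi> (x, t, 0, - 1)) / 2 - \<psi> (x, t, 0, 0)" for x t
    unfolding \<psi> B_def by (simp_all add: field_simps)
  define Ax At where "Ax = (\<lambda>x t. \<psi>x x t 0)" and "At = (\<lambda>x t. \<psi>t x t 0)"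
  define Bx Bt where "Bx = (\<lambda>x t. (\<psi>x x t 1 - \<psi>x x t (- 1)) / 2)"
    and "Bt = (\<lambda>x t. (\<psi>t x t 1 - \<psi>t x t (- 1)) / 2)"
  define Cx Ct where "Cx = (\<lambda>x t. (\<psi>x x t 1 + \<psi>x x t (- 1)) / 2 - \<psi>x x t 0)"
    and "Ct = (\<lambda>x t. (\<psi>t x t 1 + \<psi>t x t (- 1)) / 2 - \<psi>t x t 0)"
  have Ax: "((\<lambda>s. \<xi>t s t) has_real_derivative Ax x t) (at x)"
    and At: "((\<lambda>s. \<xi>t x s) has_real_derivative At x t) (at t)" for x t
    unfolding A_eq Ax_def At_def by (rule \<psi>x \<psi>t)+
  have Bx: "((\<lambda>s. B s t) has_real_derivative Bx x t) (at x)"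
    and Bt: "((\<lambda>s. B x s) has_real_derivative Bt x t) (at t)" for x t
    unfolding B_eq Bx_def Bt_def by (auto intro!: derivative_eq_intros \<psi>x \<psi>t)
  have Cx: "((\<lambda>s. - \<tau>x s t) has_real_derivative Cx x t) (at x)"
    and Ct: "((\<lambda>s. - \<tau>x x s) has_real_derivative Ct x t) (at t)" for x t
    unfolding C_eq Cx_def Ct_def by (auto intro!: derivative_eq_intros \<psi>x \<psi>t)
  have \<psi>': "\<psi> (x, t, 0, v) = \<xi>t x t + v * B x t + v\<^sup>2 * (- \<tau>x x t)" for x t v
    unfolding \<psi> B_def by simp
  have \<psi>x_eq: "\<psi>x x t v = Ax x t + v * Bx x t + v\<^sup>2 * Cx x t" for x t v
  proof (rule DERIV_unique[OF \<psi>x])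
    show "((\<lambda>s. \<psi> (s, t, 0, v)) has_real_derivative Ax x t + v * Bx x t + v\<^sup>2 * Cx x t) (at x)"
      unfolding \<psi>' by (intro DERIV_add DERIV_cmult Ax Bx Cx)
  qed
  have \<psi>t_eq: "\<psi>t x t v = At x t + v * Bt x t + v\<^sup>2 * Ct x t" for x t v
  proof (rule DERIV_unique[OF \<psi>t])
    show "((\<lambda>s. \<psi> (x, s, 0, v)) has_real_derivative At x t + v * Bt x t + v\<^sup>2 * Ct x t) (at t)"
      unfolding \<psi>' by (intro DERIV_add DERIV_cmult At Bt Ct)
  qed
  \<comment> \<open>The expression in \<open>transport\<close> is a cubic in v; its zeros at 0, 1,
    -1 and 2 make all four coefficients vanish.\<close>
  have "At x t = 0 \<and> Bt x t = - Ax x t \<and> Bx x t = - Ct x t \<and> Cx x t = 0" for x t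
    using transport[of x t 0] transport[of x t 1] transport[of x t "- 1"] transport[of x t 2]
    unfolding \<psi>x_eq \<psi>t_eq by simp
  with At Bt Bx Cx have coeffs:
    "((\<lambda>s. \<xi>t x s) has_real_derivative 0) (at t)"
    "((\<lambda>s. B x s) has_real_derivative - Ax x t) (at t)"
    "((\<lambda>s. B s t) has_real_derivative - Ct x t) (at x)"
    "((\<lambda>s. - \<tau>x s t) has_real_derivative 0) (at x)" for x t
    by metis+
  have "((\<lambda>s. \<tau> (s, t)) has_real_derivative - (- \<tau>x x t)) (at x)" for x t
    using \<tau>x by simp
  from \<xi>x \<xi>t this \<tau>t fun_cong[OF fun_cong[OF B_def]] Ax Ct coeffs show thesis
    by (rule coefficient_equations_solution) (rule that)
qed

section \<open>The classification in both directions\<close>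

theorem mainTheorem6:
  fixes \<xi> \<tau> :: "real \<times> real \<Rightarrow> real"
    and \<phi> \<psi> :: "real \<times> real \<times> real \<times> real \<Rightarrow> real"
  assumes "smooth \<xi>" and "smooth \<tau>" and "smooth \<phi>" and "smooth \<psi>"
  shows "infinitesimal_symmetry \<xi> \<tau> \<phi> \<psi> \<longleftrightarrow>
    (\<exists>(c1::real) (c2::real) (c3::real) (c4::real) (c5::real) (c6::real) (c7::real) (c8::real)
      (\<alpha> :: real \<times> real \<times> real \<Rightarrow> real).
        smooth \<alpha> \<and>
        (\<forall>x t v. c8 + c5 * v + deriv (\<lambda>s. \<alpha> (x, s, v)) t + v * deriv (\<lambda>s. \<alpha> (s, t, v)) x = 0) \<and>
        (\<forall>x t. \<xi> (x, t) = c1 + c3 * t + (c2 + c8 * t) * x + c5 * x\<^sup>2) \<and>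
        (\<forall>x t. \<tau> (x, t) = c6 + (c7 + c8 * t) * t + (c4 + c5 * t) * x) \<and>
        (\<forall>x t u v. \<phi> (x, t, u, v) = u * \<alpha> (x, t, v)) \<and>
        (\<forall>x t u v. \<psi> (x, t, u, v) =
           c3 + c2 * v + 2 * c5 * x * v + c8 * (t * v + x)
           - v * (c7 + 2 * c8 * t + c5 * x) - v\<^sup>2 * (c4 + c5 * t)))"
    (is "_ \<longleftrightarrow> ?classified")
proof
  assume sym: "infinitesimal_symmetry \<xi> \<tau> \<phi> \<psi>"
  obtain c1 c2 c3 c4 c5 c6 c7 c8 where
    \<xi>: "\<And>x t. \<xi> (x, t) = c1 + c3 * t + (c2 + c8 * t) * x + c5 * x\<^sup>2" and
    \<tau>: "\<And>x t. \<tau> (x, t) = c6 + (c7 + c8 * t) * t + (c4 + c5 * t) * x"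
    using infinitesimal_symmetry_imp_base_coefficients[OF assms(1,2,4) sym] by metis
  note eqs = sym[unfolded determining_equations Let_def deriv_base_coefficients[OF \<xi> \<tau>], rule_format]
  have \<psi>: "\<psi> (x, t, u, v) =
      c3 + c8 * x + v * (c2 + c8 * t + 2 * c5 * x - (c7 + 2 * c8 * t + c5 * x)) - v\<^sup>2 * (c4 + c5 * t)"
    for x t u v
    using eqs by blast
  have \<psi>x: "deriv (\<lambda>s. \<psi> (s, t, u, v)) x = c8 + c5 * v" for x t u v
    unfolding \<psi> by (rule DERIV_imp_deriv) (auto intro!: derivative_eq_intros)
  have \<psi>v: "deriv (\<lambda>s. \<psi> (x, t, u, s)) v =
      c2 + c8 * t + 2 * c5 * x - (c7 + 2 * c8 * t + c5 * x) - 2 * v * (c4 + c5 * t)" for x t u v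
    unfolding \<psi> by (rule DERIV_imp_deriv) (auto intro!: derivative_eq_intros)
  \<comment> \<open>Once \<phi> is linear in u, its slope is its value at u = 1.\<close>
  define \<alpha> where "\<alpha> = (\<lambda>(x, t, v). \<phi> (x, t, 1, v))"
  have \<phi>: "\<phi> (x, t, u, v) = u * \<alpha> (x, t, v)" for x t u v
  proof -
    have "((\<lambda>s. \<phi> (x, t, s, v)) has_real_derivative deriv (\<lambda>s. \<phi> (x, t, s, v)) s) (at s)" for s
      by (rule DERIV_deriv_compose[OF smooth_imp_differentiable[OF assms(3)]])
        (auto intro!: derivative_intros)
    \<comment> \<open>The v-derivative of \<psi> cancels the terms from \<xi> and \<tau> in the last
      determining equation, leaving Euler's relation in u.\<close>
    moreover have "\<phi> (x, t, s, v) = s * deriv (\<lambda>s. \<phi> (x, t, s, v)) s" for s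
      using eqs[where x = x and t = t and u = s and v = v] unfolding \<psi>v by (simp add: algebra_simps)
    ultimately show ?thesis
      unfolding \<alpha>_def prod.case by (rule Euler_homogeneous_imp_linear)
  qed
  have "smooth \<alpha>"
    unfolding smooth_def
  proof
    fix k
    have "((\<lambda>(x, t, v). (x, t, 1, v)) has_derivative (\<lambda>(x, t, v). (x, t, 0, v))) (at p)"
      for p :: "real \<times> real \<times> real"
      unfolding case_prod_beta by (auto intro!: derivative_eq_intros)
    from cont_diff_compose_affine[OF this] assms(3) have "cont_diff k (\<lambda>p. \<phi> ((\<lambda>(x, t, v). (x, t, 1, v)) p))"
      unfolding smooth_def by blast
    then show "cont_diff k \<alpha>"
      unfolding \<alpha>_def by (simp add: case_prod_unfold)
  qed
  \<comment> \<open>This is the first determining equation at u = 1.\<close>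
  moreover have "c8 + c5 * v + deriv (\<lambda>s. \<alpha> (x, s, v)) t + v * deriv (\<lambda>s. \<alpha> (s, t, v)) x = 0" for x t v
    using eqs[where x = x and t = t and u = 1 and v = v] unfolding \<psi>x by (simp add: \<alpha>_def)
  moreover have "\<psi> (x, t, u, v) = c3 + c2 * v + 2 * c5 * x * v + c8 * (t * v + x)
      - v * (c7 + 2 * c8 * t + c5 * x) - v\<^sup>2 * (c4 + c5 * t)" for x t u v
    unfolding \<psi>[of x t u v] by (simp add: algebra_simps)
  ultimately show ?classified
    using \<xi> \<tau> \<phi> by blast
next
  assume ?classified
  then obtain c1 c2 c3 c4 c5 c6 c7 c8 \<alpha> where "smooth \<alpha>"
    and \<alpha>: "\<And>x t v. c8 + c5 * v + deriv (\<lambda>s. \<alpha> (x, s, v)) t + v * deriv (\<lambda>s. \<alpha> (s, t, v)) x = 0"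
    and \<xi>: "\<And>x t. \<xi> (x, t) = c1 + c3 * t + (c2 + c8 * t) * x + c5 * x\<^sup>2"
    and \<tau>: "\<And>x t. \<tau> (x, t) = c6 + (c7 + c8 * t) * t + (c4 + c5 * t) * x"
    and \<phi>: "\<And>x t u v. \<phi> (x, t, u, v) = u * \<alpha> (x, t, v)"
    and \<psi>: "\<And>x t u v. \<psi> (x, t, u, v) = c3 + c2 * v + 2 * c5 * x * v + c8 * (t * v + x)
           - v * (c7 + 2 * c8 * t + c5 * x) - v\<^sup>2 * (c4 + c5 * t)"
    by metis
  note D = DERIV_deriv_compose[OF smooth_imp_differentiable[OF \<open>smooth \<alpha>\<close>]]
  have \<psi>x: "deriv (\<lambda>s. \<psi> (s, t, u, v)) x = c8 + c5 * v"
    and \<psi>t: "deriv (\<lambda>s. \<psi> (x, s, u, v)) t = - (c8 * v) - c5 * v\<^sup>2"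
    and \<psi>u: "deriv (\<lambda>s. \<psi> (x, t, s, v)) u = 0"
    and \<psi>v: "deriv (\<lambda>s. \<psi> (x, t, u, s)) v =
      c2 + 2 * c5 * x + c8 * t - (c7 + 2 * c8 * t + c5 * x) - 2 * v * (c4 + c5 * t)" for x t u v
    unfolding \<psi> by (rule DERIV_imp_deriv, auto intro!: derivative_eq_intros)+
  have \<phi>x: "deriv (\<lambda>s. \<phi> (s, t, u, v)) x = u * deriv (\<lambda>s. \<alpha> (s, t, v)) x"
    and \<phi>t: "deriv (\<lambda>s. \<phi> (x, s, u, v)) t = u * deriv (\<lambda>s. \<alpha> (x, s, v)) t"
    and \<phi>u: "deriv (\<lambda>s. \<phi> (x, t, s, v)) u = \<alpha> (x, t, v)" for x t u v
    unfolding \<phi>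
    by (rule DERIV_imp_deriv, auto intro!: derivative_eq_intros D)+
  \<comment> \<open>The first determining equation is u times the constraint on \<alpha>.\<close>
  have "u * deriv (\<lambda>s. \<alpha> (x, s, v)) t + v * (u * deriv (\<lambda>s. \<alpha> (s, t, v)) x) + u * (c8 + c5 * v) =
      u * (c8 + c5 * v + deriv (\<lambda>s. \<alpha> (x, s, v)) t + v * deriv (\<lambda>s. \<alpha> (s, t, v)) x)" for x t u v
    by (simp add: algebra_simps)
  then have "u * deriv (\<lambda>s. \<alpha> (x, s, v)) t + v * (u * deriv (\<lambda>s. \<alpha> (s, t, v)) x) + u * (c8 + c5 * v) = 0"
    for x t u v
    unfolding \<alpha> by simp
  then show "infinitesimal_symmetry \<xi> \<tau> \<phi> \<psi>"
    unfolding determining_equations Let_def deriv_base_coefficients[OF \<xi> \<tau>] \<psi>x \<psi>t \<psi>u \<psi>v \<phi>x \<phi>t \<phi>u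
    by (simp add: \<phi> \<psi> algebra_simps power2_eq_square)
qed

end
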